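(* Let $d$ be a positive integer. Then the family of real polynomials $$\left(\binom{X + d}{d} (X + d)^k - \binom{X}{d} X^k\right)_{k \in \mathbb{N}}$$ constitutes a basis of the $\mathbb{R}$-vector space $\mathscr{E}_d$.
   Context: Here $\mathbb{N} = \{0, 1, 2, \dots\}$, and $\binom{X}{m} := \frac{X(X-1)\cdots(X-m+1)}{m!} \in \mathbb{R}[X]$ for $m \in \mathbb{N}$. For a positive integer $d$, $\mathscr{E}_d$ denotes the set (an $\mathbb{R}$-linear subspace of $\mathbb{R}[X]$) of all polynomials $P \in \mathbb{R}[X]$ for which the sum $P(n) + P(n-d) + P(n-2d) + \cdots := \sum_{0 \leq k \leq n/d} P(n - k d)$ (the sum over integers $k \ge 0$ with $n - kd \geq 0$) is polynomial in $n \in \mathbb{N}$, i.e. there exists $S \in \mathbb{R}[X]$ such that this sum equals $S(n)$ for all $n \in \mathbb{N}$. *)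

theory Defs
  imports Complex_Main "HOL-Computational_Algebra.Polynomial"
begin

global_interpretation real_poly: vector_space "smult :: real \<Rightarrow> real poly \<Rightarrow> real poly"
  by unfold_locales (simp_all add: smult_add_right smult_add_left)

text \<open>A family is a basis of the subspace \<open>V\<close>. Injectivity together with independence of the
  range is linear independence of the family, repeated members being excluded.\<close>

definition (in vector_space) basis_family :: "('i \<Rightarrow> 'b) \<Rightarrow> 'b set \<Rightarrow> bool" where
  "basis_family f V \<longleftrightarrow> inj f \<and> independent (range f) \<and> span (range f) = V"

text \<open>The polynomial \<open>X (X - 1) \<dots> (X - m + 1) / m!\<close>; the library's \<open>gchoose\<close> is
  restricted to fields.\<close>

definition binom_poly :: "nat \<Rightarrow> real poly" where
  "binom_poly m = smult (1 / fact m) (\<Prod>i<m. [:- real i, 1:])"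

lemma poly_binom_poly: "poly (binom_poly m) x = x gchoose m"
  by (simp add: binom_poly_def poly_prod gbinomial_prod_rev atLeast0LessThan)

text \<open>For \<open>d > 0\<close>, the integers \<open>k\<close> with \<open>0 \<le> k \<le> n / d\<close> are those in \<open>{..n div d}\<close>.\<close>

definition poly_sum_space :: "nat \<Rightarrow> real poly set" where
  "poly_sum_space d =
     {P. \<exists>S :: real poly. \<forall>n::nat. (\<Sum>k\<le>n div d. poly P (real n - real k * real d)) = poly S (real n)}"

lemma subspace_poly_sum_space: "real_poly.subspace (poly_sum_space d)"
proof (rule real_poly.subspaceI)
  show "0 \<in> poly_sum_space d"
    by (auto simp: poly_sum_space_def intro: exI[of _ 0])
next
  fix P Q assume "P \<in> poly_sum_space d" "Q \<in> poly_sum_space d"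
  then obtain S T :: "real poly" where
    "\<forall>n. (\<Sum>k\<le>n div d. poly P (real n - real k * real d)) = poly S (real n)"
    "\<forall>n. (\<Sum>k\<le>n div d. poly Q (real n - real k * real d)) = poly T (real n)"
    by (auto simp: poly_sum_space_def)
  then show "P + Q \<in> poly_sum_space d"
    by (auto simp: poly_sum_space_def sum.distrib intro!: exI[of _ "S + T"])
next
  fix c P assume "P \<in> poly_sum_space d"
  then obtain S :: "real poly" where
    "\<forall>n. (\<Sum>k\<le>n div d. poly P (real n - real k * real d)) = poly S (real n)"
    by (auto simp: poly_sum_space_def)
  then show "smult c P \<in> poly_sum_space d"
    by (auto simp: poly_sum_space_def sum_distrib_left[symmetric] intro!: exI[of _ "smult c S"])
qed

end

theory Submission
  imports Defs
begin

text \<open>If the sums of \<open>P\<close> with step \<open>d\<close> are given by a polynomial \<open>S\<close>, then \<open>T = S(X - d)\<close>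
  satisfies \<open>P = T(X + d) - T(X)\<close> and vanishes at \<open>0, \<dots>, d - 1\<close>, so it is a multiple of
  \<open>binom_poly d\<close>; the converse is telescoping. Hence the space is the range of the
  linear map \<open>Q \<mapsto> (binom_poly d * Q)(X + d) - (binom_poly d * Q)(X)\<close>. It is injective
  because periodic polynomials are constant and \<open>binom_poly d\<close> has a root. The family in question is the
  image of the monomial basis.\<close>

lemma poly_eqI_nat:
  fixes p q :: "real poly"
  assumes "\<And>n::nat. poly p (real n) = poly q (real n)"
  shows "p = q"
proof (rule ccontr)
  assume "p \<noteq> q"
  then have "finite {x. poly (p - q) x = 0}"
    by (intro poly_roots_finite) simp
  moreover have "range real \<subseteq> {x. poly (p - q) x = 0}"
    using assms by auto
  ultimately show False
    using finite_subset range_inj_infinite[OF inj_of_nat] by blast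
qed

lemma prod_linear_dvd:
  fixes p :: "'a::field poly"
  assumes "finite A" "\<And>a. a \<in> A \<Longrightarrow> poly p a = 0"
  shows "(\<Prod>a\<in>A. [:- a, 1:]) dvd p"
  using assms
proof (induction A)
  case empty
  then show ?case by simp
next
  case (insert b A)
  then obtain q where q: "p = (\<Prod>a\<in>A. [:- a, 1:]) * q"
    by (auto elim: dvdE)
  \<comment> \<open>Since \<open>b\<close> lies outside \<open>A\<close>, the root of
    \<open>p\<close> at \<open>b\<close> has to come from the cofactor \<open>q\<close>.\<close>
  have "poly (\<Prod>a\<in>A. [:- a, 1:]) b \<noteq> 0"
    using insert.hyps by (auto simp: poly_prod)
  with insert.prems[of b] q have "[:- b, 1:] dvd q"
    by (simp add: poly_eq_0_iff_dvd)
  then have "(\<Prod>a\<in>A. [:- a, 1:]) * [:- b, 1:] dvd p"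
    unfolding q by (rule mult_dvd_mono[OF dvd_refl])
  then show ?case
    using insert.hyps by (simp add: mult.commute)
qed

lemma binom_poly_dvd:
  assumes "\<And>i. i < d \<Longrightarrow> poly p (real i) = 0"
  shows "binom_poly d dvd p"
proof -
  have "(\<Prod>a\<in>real ` {..<d}. [:- a, 1:]) dvd p"
    using assms by (intro prod_linear_dvd) auto
  \<comment> \<open>The scalar \<open>1 / fact d\<close> is a unit, so it does not affect
    divisibility.\<close>
  then show ?thesis
    by (simp add: binom_poly_def prod.reindex smult_dvd_iff)
qed

lemma poly_binom_poly_eq_0: "i < d \<Longrightarrow> poly (binom_poly d) (real i) = 0"
  by (auto simp: binom_poly_def poly_prod)

lemma binom_poly_nonzero: "binom_poly d \<noteq> 0"
  by (simp add: binom_poly_def)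

text \<open>Periodicity fixes the value at every multiple of \<open>c\<close>. Rescaling the
  variable by \<open>c\<close> turns these multiples into the natural numbers, where agreement with
  a constant forces equality; substituting X / c undoes the rescaling.\<close>

lemma periodic_poly_constant:
  fixes p :: "real poly"
  assumes "pcompose p [:c, 1:] = p" "c \<noteq> 0"
  shows "p = [:poly p 0:]"
proof -
  have step: "poly p (c + x) = poly p x" for x
    using assms(1) by (metis poly_pcompose poly_pCons poly_0 mult_zero_right add.right_neutral mult.right_neutral)
  have "poly p (c * real n) = poly p 0" for n
  proof (induction n)
    case (Suc n)
    then show ?case using step[of "c * real n"] by (simp add: algebra_simps)
  qed simp
  then have "pcompose p [:0, c:] = [:poly p 0:]"
    by (intro poly_eqI_nat) (simp add: poly_pcompose mult.commute)
  then have "pcompose (pcompose p [:0, c:]) [:0, 1 / c:] = [:poly p 0:]"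
    by simp
  then show ?thesis
    using assms(2) by (simp add: pcompose_assoc[symmetric] pcompose_pCons pcompose_idR)
qed

definition shift_diff :: "nat \<Rightarrow> real poly \<Rightarrow> real poly" where
  "shift_diff d p = pcompose p [:real d, 1:] - p"

lemma poly_shift_diff: "poly (shift_diff d p) x = poly p (x + real d) - poly p x"
  by (simp add: shift_diff_def poly_pcompose add.commute)

text \<open>The sum telescopes, and the smallest argument reached is
  \<open>n - (n div d) * d = n mod d\<close>.\<close>

lemma sum_shift_diff:
  fixes d n :: nat
  shows "(\<Sum>k\<le>n div d. poly (shift_diff d p) (real n - real k * real d))
    = poly p (real n + real d) - poly p (real (n mod d))"
proof -
  have "(\<Sum>k\<le>m. poly (shift_diff d p) (x - real k * real d))
      = poly p (x + real d) - poly p (x - real m * real d)" for m x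
    by (induction m) (simp_all add: poly_shift_diff algebra_simps)
  moreover have "real n - real (n div d) * real d = real (n mod d)"
    by (metis add_diff_cancel_left' div_mult_mod_eq of_nat_add of_nat_mult)
  ultimately show ?thesis
    by simp
qed

lemma poly_sum_space_eq_range:
  assumes "d > 0"
  shows "poly_sum_space d = range (\<lambda>Q. shift_diff d (binom_poly d * Q))"
proof (intro equalityI subsetI)
  fix P assume "P \<in> poly_sum_space d"
  then obtain S where
    S: "\<And>n::nat. (\<Sum>k\<le>n div d. poly P (real n - real k * real d)) = poly S (real n)"
    by (auto simp: poly_sum_space_def)
  define T where "T = pcompose S [:- real d, 1:]"
  have polyT: "poly T x = poly S (x - real d)" for x
    by (simp add: T_def poly_pcompose)
  \<comment> \<open>Splitting off the term \<open>k = 0\<close> from the sum for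
    \<open>n + d\<close> leaves the sum for \<open>n\<close>. Starting at \<open>n + d\<close> keeps
    every argument of \<open>S\<close> in the range where \<open>S\<close> is known to equal a
    sum.\<close>
  have rec: "poly S (real n + real d) = poly P (real n + real d) + poly S (real n)" for n
  proof -
    have "poly S (real (n + d)) = (\<Sum>k\<le>Suc (n div d). poly P (real (n + d) - real k * real d))"
      using S[of "n + d"] assms by simp
    also have "\<dots> = poly P (real (n + d))
        + (\<Sum>k\<le>n div d. poly P (real (n + d) - real (Suc k) * real d))"
      by (subst sum.atMost_Suc_shift) simp
    also have "\<dots> = poly P (real (n + d)) + poly S (real n)"
      unfolding S[symmetric] by (simp add: algebra_simps)
    finally show ?thesis by simp
  qed
  \<comment> \<open>The recurrence determines \<open>P\<close> only at the points
    \<open>n + d\<close>, so the shifted polynomials are compared first and the shift is then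
    undone.\<close>
  have "pcompose P [:real d, 1:] = pcompose (shift_diff d T) [:real d, 1:]"
    using rec by (intro poly_eqI_nat) (simp add: poly_pcompose poly_shift_diff polyT add.commute)
  then have "pcompose (pcompose P [:real d, 1:]) [:- real d, 1:]
      = pcompose (pcompose (shift_diff d T) [:real d, 1:]) [:- real d, 1:]"
    by simp
  then have P: "P = shift_diff d T"
    by (simp add: pcompose_assoc[symmetric] pcompose_pCons pcompose_idR)
  \<comment> \<open>For \<open>i < d\<close> the sum has the single term P(i), so S(i) = P(i) = T(i
    + d) - T(i) = S(i) - T(i).\<close>
  have "poly T (real i) = 0" if "i < d" for i
    using S[of i] that by (simp add: P poly_shift_diff polyT)
  then obtain Q where "T = binom_poly d * Q"
    using binom_poly_dvd by (metis dvdE)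
  with P show "P \<in> range (\<lambda>Q. shift_diff d (binom_poly d * Q))"
    by blast
next
  fix P assume "P \<in> range (\<lambda>Q. shift_diff d (binom_poly d * Q))"
  then obtain Q where P: "P = shift_diff d (binom_poly d * Q)"
    by blast
  let ?T = "binom_poly d * Q"
  \<comment> \<open>This is the lower boundary term of the telescoping sum, the only one that need
    not be polynomial in \<open>n\<close>.\<close>
  have "poly ?T (real (n mod d)) = 0" for n
    using assms by (simp add: poly_binom_poly_eq_0)
  then have "(\<Sum>k\<le>n div d. poly P (real n - real k * real d))
      = poly (pcompose ?T [:real d, 1:]) (real n)" for n
    unfolding P sum_shift_diff by (simp add: poly_pcompose add.commute)
  then show "P \<in> poly_sum_space d"
    unfolding poly_sum_space_def by blast
qed

lemma inj_shift_diff_binom: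
  assumes "d > 0"
  shows "inj (\<lambda>Q. shift_diff d (binom_poly d * Q))"
proof (rule injI)
  fix Q R assume eq: "shift_diff d (binom_poly d * Q) = shift_diff d (binom_poly d * R)"
  define p where "p = binom_poly d * (Q - R)"
  have "pcompose p [:real d, 1:] = p"
    using eq by (simp add: p_def shift_diff_def algebra_simps pcompose_diff)
  then have "p = [:poly p 0:]"
    using assms by (intro periodic_poly_constant) auto
  \<comment> \<open>As \<open>d > 0\<close>, the roots of \<open>binom_poly d\<close> include 0,
    which makes the constant vanish.\<close>
  moreover have "poly p 0 = 0"
    using poly_binom_poly_eq_0[OF assms] by (simp add: p_def)
  ultimately have "p = 0"
    by simp
  then show "Q = R"
    using binom_poly_nonzero by (simp add: p_def)
qed

lemma basis_family_monom: "real_poly.basis_family (monom 1) UNIV"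
  unfolding real_poly.basis_family_def
proof (intro conjI)
  show inj: "inj (monom (1::real))"
    by (rule injI) (simp add: monom_eq_iff')
  show "real_poly.independent (range (monom 1))"
    unfolding real_poly.dependent_explicit
  proof safe
    fix S u v
    assume S: "finite S" "S \<subseteq> range (monom (1::real))" "v \<in> S"
      and 0: "(\<Sum>v\<in>S. smult (u v) v) = 0" and u: "u v \<noteq> 0"
    \<comment> \<open>Indexing the relation by exponents lets the coefficient at \<open>k\<close>
      isolate \<open>u v\<close>.\<close>
    from S(1,2) obtain K where K: "finite K" "S = monom 1 ` K"
      by (meson finite_subset_image)
    from K(2) S(3) obtain k where k: "k \<in> K" "v = monom 1 k"
      by auto
    have "(\<Sum>j\<in>K. monom (u (monom 1 j)) j) = 0"
      using 0 inj by (simp add: K(2) sum.reindex inj_on_subset[OF inj] smult_monom)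
    then have "coeff (\<Sum>j\<in>K. monom (u (monom 1 j)) j) k = 0"
      by simp
    then show False
      using K(1) k u by (simp add: coeff_sum)
  qed
  have "p \<in> real_poly.span (range (monom 1))" for p :: "real poly"
  proof -
    have "p = (\<Sum>i\<le>degree p. smult (coeff p i) (monom 1 i))"
      by (simp add: smult_monom poly_as_sum_of_monoms)
    also have "\<dots> \<in> real_poly.span (range (monom 1))"
      by (intro real_poly.span_sum real_poly.span_scale real_poly.span_base) auto
    finally show ?thesis .
  qed
  then show "real_poly.span (range (monom 1)) = UNIV"
    by auto
qed

text \<open>Injectivity of \<open>L\<close> preserves both independence and the distinctness of the
  members, and spans commute with linear maps.\<close>

lemma basis_family_linear_image:
  assumes "Vector_Spaces.linear smult smult L" "inj L" "real_poly.basis_family f UNIV"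
  shows "real_poly.basis_family (\<lambda>k. L (f k)) (range L)"
proof -
  interpret vector_space_pair "smult :: real \<Rightarrow> real poly \<Rightarrow> real poly"
      "smult :: real \<Rightarrow> real poly \<Rightarrow> real poly"
    by unfold_locales
  have img: "range (\<lambda>k. L (f k)) = L ` range f"
    by auto
  show ?thesis
    using assms(3) unfolding real_poly.basis_family_def img
    using assms(2) linear_independent_injective_image[OF assms(1)] linear_span_image[OF assms(1)]
    by (auto simp: inj_def inj_on_def)
qed

theorem corollary2p2:
  fixes d :: nat
  assumes "d > 0"
  shows "real_poly.basis_family
           (\<lambda>k::nat. pcompose (binom_poly d) [:real d, 1:] * [:real d, 1:] ^ k
                     - binom_poly d * [:0, 1:] ^ k)
           (poly_sum_space d)"
proof -
  let ?L = "\<lambda>Q. shift_diff d (binom_poly d * Q)"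
  have linear: "Vector_Spaces.linear smult smult ?L"
    by unfold_locales
      (simp_all add: shift_diff_def pcompose_add pcompose_smult smult_diff_right algebra_simps)
  \<comment> \<open>Composition is multiplicative, so shifting
    \<open>binom_poly d * monom 1 k\<close> shifts each factor, which yields the stated
    family.\<close>
  have "pcompose (monom 1 k) [:real d, 1:] = [:real d, 1:] ^ k" for k
    by (induction k) (simp_all add: monom_0 monom_Suc pcompose_pCons)
  then have "?L (monom 1 k) = pcompose (binom_poly d) [:real d, 1:] * [:real d, 1:] ^ k
                     - binom_poly d * [:0, 1:] ^ k" for k
    by (simp add: shift_diff_def pcompose_mult monom_altdef)
  then show ?thesis
    using basis_family_linear_image[OF linear inj_shift_diff_binom[OF assms] basis_family_monom]
    by (simp add: poly_sum_space_eq_range[OF assms])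
qed

end
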